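(* Let $\alpha=\alpha(t)$, $t\in I_1$, and $\omega=\omega(s)$, $s\in I_2$, be regular planar curves with values in $\mathbb{C}\setminus\{0\}$ ($I_1,I_2$ intervals of $\mathbb{R}$), and let $\Phi=\alpha\ast\omega$ be the associated Lagrangian immersion. Then $\Phi$ is special Lagrangian if and only if $\alpha$ and $\omega$ are straight lines (that is, the trace of each is contained in a straight line). Moreover, putting $\alpha(t)=t+i\,a$ and $\omega(s)=s+i\,b$ with $a,b\in\mathbb{R}$, the map $\Phi=\alpha\ast\omega$ can be written, up to a translation in $\mathbb{C}^2$, as $$\Phi(t,s)=\left(\frac{s^2-t^2}{2}+i(at-bs),\ ts+i(as+bt)\right),\quad (t,s)\in\mathbb{R}^2 .$$ If $(a,b)=(0,0)$, the image of this map is the totally geodesic Lagrangian plane $\mathbb{R}^2\subset\mathbb{C}^2$, $\Phi(t,s)=\left(\frac{s^2-t^2}{2},ts\right)$. If $(a,b)\neq(0,0)$, these special Lagrangians correspond to the holomorphic curves $z\mapsto c\,z^2$ with $c=-\frac{(a-ib)^2}{2(a^2+b^2)^2}\in\mathbb{C}\setminus\{0\}$; that is, there is an $\mathbb{R}$-linear isometry of $\mathbb{C}^2\equiv\mathbb{R}^4$ mapping the image of $\Phi$ onto the graph $\{(z,c\,z^2):z\in\mathbb{C}\}$.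
   Context: For planar curves $\alpha(t),\omega(s)$ and base points $t_0\in I_1,s_0\in I_2$, $$(\alpha\ast\omega)(t,s)=\left(\int_{s_0}^s\dot\omega(y)\overline{\omega(y)}\,dy-\int_{t_0}^t\alpha'(x)\overline{\alpha(x)}\,dx\, ,\ \alpha(t)\omega(s)\right)\in\mathbb{C}^2;$$ changing the base points changes the map only by a translation. When $\alpha,\omega$ are regular with values in $\mathbb{C}\setminus\{0\}$ this is a Lagrangian immersion with induced metric $(|\alpha|^2+|\omega|^2)(|\alpha'|^2dt^2+|\dot\omega|^2ds^2)$. The same formula is used to define $\alpha\ast\omega$ when the curves pass through $0$; it then fails to be an immersion exactly at points $(t^*,s^* )$ with $\alpha(t^* )=0=\omega(s^* )$. An immersion in $\mathbb{C}^2$ is Lagrangian if the Kaehler form $-\mathrm{Im}(\ ,\ )$ pulls back to zero, where $(z,w)=z_1\bar w_1+z_2\bar w_2$. The Lagrangian angle $\beta$ of a Lagrangian immersion $\Phi$ of an oriented surface $M$ with area form $\omega_M$ is defined by $\Phi^*(dz_1\wedge dz_2)=e^{i\beta}\omega_M$. A Lagrangian oriented surface is special if its Lagrangian angle is constant; equivalently its mean curvature vector $H$ vanishes identically. *)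

theory Defs
  imports "HOL-Analysis.Analysis"
begin

text \<open>
  \<open>\<complex>\<^sup>2\<close> is the type \<open>complex \<times> complex\<close>; its library inner product is the real part of the
  Hermitian form below.  Surfaces are given by maps \<open>F\<close> on a set \<open>S \<subseteq> \<real>\<^sup>2\<close> of parameters \<open>(t, s)\<close>,
  oriented by \<open>dt \<and> ds\<close>.  All derivatives are taken within the parameter domain, so that intervals
  may contain endpoints; on products of nondegenerate intervals they are uniquely determined.
\<close>

subsection \<open>Lagrangian immersions in \<open>\<complex>\<^sup>2\<close>\<close>

definition herm :: "complex \<times> complex \<Rightarrow> complex \<times> complex \<Rightarrow> complex" where
  "herm z w = fst z * cnj (fst w) + snd z * cnj (snd w)"

definition kaehler :: "complex \<times> complex \<Rightarrow> complex \<times> complex \<Rightarrow> real" where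
  "kaehler z w = - Im (herm z w)"

definition dz1_wedge_dz2 :: "complex \<times> complex \<Rightarrow> complex \<times> complex \<Rightarrow> complex" where
  "dz1_wedge_dz2 z w = fst z * snd w - snd z * fst w"

definition differential ::
  "(real \<times> real) set \<Rightarrow> (real \<times> real \<Rightarrow> complex \<times> complex) \<Rightarrow> real \<times> real
    \<Rightarrow> real \<times> real \<Rightarrow> complex \<times> complex" where
  "differential S F p = frechet_derivative F (at p within S)"

definition immersion_on ::
  "(real \<times> real) set \<Rightarrow> (real \<times> real \<Rightarrow> complex \<times> complex) \<Rightarrow> bool" where
  "immersion_on S F \<longleftrightarrow>
     (\<forall>p\<in>S. F differentiable (at p within S)) \<and>
     (\<forall>v. continuous_on S (\<lambda>p. differential S F p v)) \<and>
     (\<forall>p\<in>S. inj (differential S F p))"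

definition lagrangian_immersion_on ::
  "(real \<times> real) set \<Rightarrow> (real \<times> real \<Rightarrow> complex \<times> complex) \<Rightarrow> bool" where
  "lagrangian_immersion_on S F \<longleftrightarrow>
     immersion_on S F \<and>
     (\<forall>p\<in>S. \<forall>u v. kaehler (differential S F p u) (differential S F p v) = 0)"

definition induced_metric ::
  "(real \<times> real) set \<Rightarrow> (real \<times> real \<Rightarrow> complex \<times> complex) \<Rightarrow> real \<times> real
    \<Rightarrow> real \<times> real \<Rightarrow> real \<times> real \<Rightarrow> real" where
  "induced_metric S F p u v = differential S F p u \<bullet> differential S F p v"

definition area_form ::
  "(real \<times> real) set \<Rightarrow> (real \<times> real \<Rightarrow> complex \<times> complex) \<Rightarrow> real \<times> real
    \<Rightarrow> real \<times> real \<Rightarrow> real \<times> real \<Rightarrow> real" where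
  "area_form S F p u v =
     sqrt (induced_metric S F p (1, 0) (1, 0) * induced_metric S F p (0, 1) (0, 1)
           - (induced_metric S F p (1, 0) (0, 1))\<^sup>2)
     * (fst u * snd v - snd u * fst v)"

text \<open>The angle is only determined modulo \<open>2\<pi>\<close>, hence a predicate on representatives \<open>\<beta>\<close>.\<close>

definition lagrangian_angle ::
  "(real \<times> real) set \<Rightarrow> (real \<times> real \<Rightarrow> complex \<times> complex) \<Rightarrow> (real \<times> real \<Rightarrow> real) \<Rightarrow> bool" where
  "lagrangian_angle S F \<beta> \<longleftrightarrow>
     (\<forall>p\<in>S. \<forall>u v. dz1_wedge_dz2 (differential S F p u) (differential S F p v)
                   = cis (\<beta> p) * of_real (area_form S F p u v))"

definition special_lagrangian_on ::
  "(real \<times> real) set \<Rightarrow> (real \<times> real \<Rightarrow> complex \<times> complex) \<Rightarrow> bool" where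
  "special_lagrangian_on S F \<longleftrightarrow>
     lagrangian_immersion_on S F \<and> (\<exists>\<beta>\<^sub>0. lagrangian_angle S F (\<lambda>_. \<beta>\<^sub>0))"

text \<open>
  The second fundamental form of an immersion into flat \<open>\<complex>\<^sup>2\<close> is the normal component of the second
  derivative; it vanishes iff the second derivative is tangential.
\<close>

definition totally_geodesic_on ::
  "(real \<times> real) set \<Rightarrow> (real \<times> real \<Rightarrow> complex \<times> complex) \<Rightarrow> bool" where
  "totally_geodesic_on S F \<longleftrightarrow>
     immersion_on S F \<and>
     (\<forall>p\<in>S. \<forall>u v. (\<lambda>q. differential S F q u) differentiable (at p within S) \<and>
        frechet_derivative (\<lambda>q. differential S F q u) (at p within S) v
          \<in> range (differential S F p))"

definition real_plane :: "real \<times> real \<Rightarrow> complex \<times> complex" where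
  "real_plane = (\<lambda>(x, y). (of_real x, of_real y))"

subsection \<open>Planar curves and the map \<open>\<alpha> \<ast> \<omega>\<close>\<close>

text \<open>
  Only class \<open>C\<^sup>1\<close> is required; smooth regular curves are covered.  A curve is contained in a straight
  line iff its trace is \<^const>\<open>collinear\<close>.
\<close>

definition regular_curve :: "real set \<Rightarrow> (real \<Rightarrow> complex) \<Rightarrow> bool" where
  "regular_curve I \<gamma> \<longleftrightarrow>
     (\<forall>x\<in>I. \<gamma> differentiable (at x within I)) \<and>
     continuous_on I (\<lambda>x. vector_derivative \<gamma> (at x within I)) \<and>
     (\<forall>x\<in>I. vector_derivative \<gamma> (at x within I) \<noteq> 0)"

definition curve_star ::
  "real set \<Rightarrow> real set \<Rightarrow> real \<Rightarrow> real \<Rightarrow> (real \<Rightarrow> complex) \<Rightarrow> (real \<Rightarrow> complex)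
    \<Rightarrow> real \<times> real \<Rightarrow> complex \<times> complex" where
  "curve_star I\<^sub>1 I\<^sub>2 t\<^sub>0 s\<^sub>0 \<alpha> \<omega> = (\<lambda>(t, s).
     ((LBINT y=s\<^sub>0..s. vector_derivative \<omega> (at y within I\<^sub>2) * cnj (\<omega> y))
        - (LBINT x=t\<^sub>0..t. vector_derivative \<alpha> (at x within I\<^sub>1) * cnj (\<alpha> x)),
      \<alpha> t * \<omega> s))"

definition line_star :: "real \<Rightarrow> real \<Rightarrow> real \<times> real \<Rightarrow> complex \<times> complex" where
  "line_star a b = (\<lambda>(t, s).
     (of_real ((s\<^sup>2 - t\<^sup>2) / 2) + \<i> * of_real (a * t - b * s),
      of_real (t * s) + \<i> * of_real (a * s + b * t)))"

end

theory Submission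
  imports Defs
begin

text \<open>
  The coordinate vectors of \<open>\<alpha> \<ast> \<omega>\<close> are orthogonal of lengths \<open>|\<alpha>'| n\<close> and \<open>|\<omega>'| n\<close> with
  \<open>n\<^sup>2 = |\<alpha>|\<^sup>2 + |\<omega>|\<^sup>2\<close>, and \<open>dz\<^sub>1 \<and> dz\<^sub>2\<close> evaluates on them to \<open>- \<alpha>' \<omega>' n\<^sup>2\<close>.  Hence \<open>e\<^sup>i\<^sup>\<beta>\<close> is minus the product
  of the unit tangents of the two curves: it is constant iff both unit tangents are, that is, iff
  both curves are straight.
\<close>

section \<open>Intervals, derivatives within them, and primitives\<close>

text \<open>Makes every point of a nondegenerate interval a limit point of it, which uniqueness of
  derivatives within \<open>I\<close> rests on. The sign of \<open>d\<close> is left open because at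
  an endpoint only one direction stays inside.\<close>

lemma interval_shift_exists:
  fixes I :: "real set"
  assumes "is_interval I" "interior I \<noteq> {}" "x \<in> I" "e > 0"
  shows "\<exists>d. 0 < \<bar>d\<bar> \<and> \<bar>d\<bar> < e \<and> x + d \<in> I"
proof -
  have "\<not> I \<subseteq> {x}"
    using assms(2) interior_mono[of I "{x}"] by auto
  then obtain y where y: "y \<in> I" "y \<noteq> x" by auto
  \<comment> \<open>The move goes from \<open>x\<close> towards \<open>y\<close> by at most
    \<open>e/2\<close> and never past \<open>y\<close>, so \<open>x + d\<close> stays in
    \<open>I\<close>.\<close>
  define d where "d = (if y > x then min (e/2) (y - x) else max (-e/2) (y - x))"
  have "0 < \<bar>d\<bar>" "\<bar>d\<bar> < e" "x \<le> x + d \<and> x + d \<le> y \<or> y \<le> x + d \<and> x + d \<le> x"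
    using y assms(4) by (auto simp: d_def min_def max_def abs_if)
  moreover from this have "x + d \<in> I"
    using assms(1,3) y mem_is_interval_1_I by metis
  ultimately show ?thesis by blast
qed

lemma has_derivative_fst_compose:
  assumes "(f has_vector_derivative f') (at t within I)"
  shows "((\<lambda>p. f (fst p)) has_derivative (\<lambda>h. fst h *\<^sub>R f')) (at (t, s) within I \<times> J)"
proof -
  \<comment> \<open>The first projection of the product is \<open>I\<close>, or empty when
    \<open>J\<close> is; restricting the derivative to a subset covers both cases.\<close>
  have "(f has_derivative (\<lambda>h. h *\<^sub>R f')) (at (fst (t, s)) within fst ` (I \<times> J))"
    using assms by (auto simp: has_vector_derivative_def intro: has_derivative_subset)
  from has_derivative_in_compose[OF has_derivative_fst[OF has_derivative_ident] this]
  show ?thesis .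
qed

lemma has_derivative_snd_compose:
  assumes "(f has_vector_derivative f') (at s within J)"
  shows "((\<lambda>p. f (snd p)) has_derivative (\<lambda>h. snd h *\<^sub>R f')) (at (t, s) within I \<times> J)"
proof -
  have "(f has_derivative (\<lambda>h. h *\<^sub>R f')) (at (snd (t, s)) within snd ` (I \<times> J))"
    using assms by (auto simp: has_vector_derivative_def intro: has_derivative_subset)
  from has_derivative_in_compose[OF has_derivative_snd[OF has_derivative_ident] this]
  show ?thesis .
qed

text \<open>Prepares the fundamental theorem of calculus on compact intervals: near
  \<open>x\<close>, a suitable compact piece containing \<open>c\<close> coincides with
  \<open>I\<close>, whatever endpoints \<open>I\<close> has, so both give the same derivative at
  \<open>x\<close>.\<close>

lemma interval_at_within_Icc:
  fixes I :: "real set"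
  assumes I: "is_interval I" and c: "c \<in> I" and x: "x \<in> I"
  obtains a b where "{a..b} \<subseteq> I" "a \<le> c" "c \<le> b" "a \<le> x" "x \<le> b"
    "at x within {a..b} = at x within I"
proof -
  \<comment> \<open>\<open>a\<close> lies strictly left of \<open>x\<close> and \<open>c\<close> if
    \<open>I\<close> reaches that far; otherwise \<open>min x c\<close> is the least element of
    \<open>I\<close>. Likewise \<open>b\<close> on the right.\<close>
  define a where "a = (if \<exists>y\<in>I. y < min x c then SOME y. y \<in> I \<and> y < min x c else min x c)"
  define b where "b = (if \<exists>y\<in>I. max x c < y then SOME y. y \<in> I \<and> max x c < y else max x c)"
  have a: "a \<in> I \<and> (a < min x c \<or> a = min x c \<and> (\<forall>y\<in>I. a \<le> y))"
  proof (cases "\<exists>y\<in>I. y < min x c")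
    case True
    then have "\<exists>y. y \<in> I \<and> y < min x c" by blast
    from someI_ex[OF this] show ?thesis using True by (simp add: a_def)
  next
    case False
    then show ?thesis using c x unfolding a_def by (auto simp: min_def not_less)
  qed
  have b: "b \<in> I \<and> (max x c < b \<or> b = max x c \<and> (\<forall>y\<in>I. y \<le> b))"
  proof (cases "\<exists>y\<in>I. max x c < y")
    case True
    then have "\<exists>y. y \<in> I \<and> max x c < y" by blast
    from someI_ex[OF this] show ?thesis using True by (simp add: b_def)
  next
    case False
    then show ?thesis using c x unfolding b_def by (auto simp: max_def not_less)
  qed
  have sub: "{a..b} \<subseteq> I"
    using a b I mem_is_interval_1_I by (metis atLeastAtMost_iff subsetI)
  \<comment> \<open>The open window around \<open>x\<close> is cut at \<open>a\<close> and
    \<open>b\<close>; on a side where \<open>x\<close> is itself the end of \<open>I\<close>, a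
    margin of 1 adds no point of \<open>I\<close>.\<close>
  define l where "l = (if a < x then a else x - 1)"
  define r where "r = (if x < b then b else x + 1)"
  have le: "a \<le> c" "c \<le> b" "a \<le> x" "x \<le> b" using a b by auto
  have "at x within {a..b} = at x within I"
  proof (rule at_within_nhd)
    show "x \<in> {l<..<r}" "open {l<..<r}" by (auto simp: l_def r_def)
    have "y \<in> {a..b}" if "y \<in> I" "y \<in> {l<..<r}" for y
      using that a b le by (auto simp: l_def r_def split: if_splits)
    then show "{a..b} \<inter> {l<..<r} - {x} = I \<inter> {l<..<r} - {x}" using sub by blast
  qed
  with sub le that show ?thesis by blast
qed

lemma interval_integral_has_vector_derivative:
  fixes f :: "real \<Rightarrow> 'a::euclidean_space"
  assumes "is_interval I" "c \<in> I" "x \<in> I" "continuous_on I f"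
  shows "((\<lambda>u. LBINT y=c..u. f y) has_vector_derivative f x) (at x within I)"
proof -
  obtain a b where ab: "{a..b} \<subseteq> I" "a \<le> c" "c \<le> b" "a \<le> x" "x \<le> b"
    "at x within {a..b} = at x within I"
    using interval_at_within_Icc[OF assms(1-3)] .
  then show ?thesis
    using interval_integral_FTC2[of a c b f x] continuous_on_subset[OF assms(4) ab(1)] by simp
qed

section \<open>Straight curves and constant unit tangents\<close>

text \<open>On a line with direction \<open>u\<close> the velocity is a real multiple of
  \<open>u\<close>, continuous and never zero, hence of constant sign on an interval. Conversely, if
  the unit tangent is always \<open>e\<close>, the coordinate of the curve orthogonal to
  \<open>e\<close> has derivative zero.\<close>

lemma regular_curve_collinear_iff:
  assumes I: "is_interval I" "interior I \<noteq> {}" and reg: "regular_curve I \<gamma>"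
  shows "collinear (\<gamma> ` I) \<longleftrightarrow> (\<exists>e. \<forall>t\<in>I. sgn (vector_derivative \<gamma> (at t within I)) = e)"
proof
  let ?d = "\<lambda>t. vector_derivative \<gamma> (at t within I)"
  have der: "(\<gamma> has_vector_derivative ?d t) (at t within I)" if "t \<in> I" for t
    using reg that by (auto simp: regular_curve_def vector_derivative_works)
  have cont: "continuous_on I ?d" and nz: "\<And>t. t \<in> I \<Longrightarrow> ?d t \<noteq> 0"
    using reg by (auto simp: regular_curve_def)
  have lim: "at t within I \<noteq> bot" if "t \<in> I" for t
  proof -
    have "\<exists>y\<in>I. y \<noteq> t \<and> dist y t < e" if "e > 0" for e
      using interval_shift_exists[OF I \<open>t \<in> I\<close> that] by (force simp: dist_real_def)
    then show ?thesis by (simp add: trivial_limit_within islimpt_approachable)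
  qed
  obtain t\<^sub>0 where t0: "t\<^sub>0 \<in> I" using I(2) interior_subset by blast
  {
    assume "collinear (\<gamma> ` I)"
    then obtain u where u: "\<And>t t'. t \<in> I \<Longrightarrow> t' \<in> I \<Longrightarrow> \<exists>c. \<gamma> t - \<gamma> t' = c *\<^sub>R u"
      unfolding collinear_def by (metis imageI)
    \<comment> \<open>A real linear functional that is constant along the curve annihilates its
      velocity.\<close>
    have der_const: "f (?d t) = 0"
      if t: "t \<in> I" and f: "bounded_linear f" and c: "\<And>t. t \<in> I \<Longrightarrow> f (\<gamma> t) = f (\<gamma> t\<^sub>0)"
      for f :: "complex \<Rightarrow> real" and t
    proof -
      have "((\<lambda>t. f (\<gamma> t)) has_vector_derivative f (?d t)) (at t within I)"
        using bounded_linear.has_vector_derivative[OF f der[OF t]] .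
      moreover have "((\<lambda>t. f (\<gamma> t)) has_vector_derivative 0) (at t within I)"
        by (rule has_vector_derivative_transform[OF t, where f = "\<lambda>t. f (\<gamma> t\<^sub>0)"]) (auto simp: c)
      ultimately show ?thesis
        using vector_derivative_unique_within[OF lim[OF t]] by blast
    qed
    \<comment> \<open>\<open>collinear\<close> permits the direction 0, but then the curve would be
      constant, against regularity.\<close>
    have "u \<noteq> 0"
    proof
      assume "u = 0"
      then have "\<gamma> t = \<gamma> t\<^sub>0" if "t \<in> I" for t using u[OF that t0] by simp
      then have "Re (?d t\<^sub>0) = 0" "Im (?d t\<^sub>0) = 0"
        using der_const[OF t0 bounded_linear_Re] der_const[OF t0 bounded_linear_Im] by auto
      then show False using nz[OF t0] by (simp add: complex_eq_iff)
    qed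
    \<comment> \<open>Up to a factor, \<open>Im (z * cnj u)\<close> is the coordinate of
      \<open>z\<close> orthogonal to \<open>u\<close>, which is constant on the line.\<close>
    have imz: "Im (?d t * cnj u) = 0" if "t \<in> I" for t
    proof (rule der_const[OF that])
      show "bounded_linear (\<lambda>z. Im (z * cnj u))"
        by (intro bounded_linear_compose[OF bounded_linear_Im] bounded_linear_mult_left)
      fix t assume "t \<in> I"
      then obtain c where "\<gamma> t - \<gamma> t\<^sub>0 = c *\<^sub>R u" using u t0 by blast
      then have "\<gamma> t = \<gamma> t\<^sub>0 + c *\<^sub>R u" by (simp add: algebra_simps)
      then show "Im (\<gamma> t * cnj u) = Im (\<gamma> t\<^sub>0 * cnj u)" by (simp add: algebra_simps)
    qed
    define g where "g t = Re (?d t * cnj u)" for t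
    have g: "?d t * cnj u = of_real (g t)" if "t \<in> I" for t
      using imz[OF that] by (simp add: complex_eq_iff g_def)
    have gnz: "g t \<noteq> 0" if "t \<in> I" for t
      using g[OF that] nz[OF that] \<open>u \<noteq> 0\<close> by auto
    have "continuous_on I g" unfolding g_def using cont by (intro continuous_intros)
    then have "is_interval (g ` I)"
      using I(1) connected_continuous_image is_interval_connected_1 by blast
    \<comment> \<open>Two opposite signs would put 0 into the interval of values of
      \<open>g\<close>.\<close>
    then have "sgn (g t) = sgn (g t\<^sub>0)" if "t \<in> I" for t
      using mem_is_interval_1_I[of "g ` I" "g t" "g t\<^sub>0" 0]
        mem_is_interval_1_I[of "g ` I" "g t\<^sub>0" "g t" 0] gnz that t0
      by (force simp: sgn_if)
    then have "sgn (?d t) * sgn (cnj u) = sgn (?d t\<^sub>0) * sgn (cnj u)" if "t \<in> I" for t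
      using g[OF that] g[OF t0] that by (metis sgn_mult sgn_of_real)
    then have "sgn (?d t) = sgn (?d t\<^sub>0)" if "t \<in> I" for t
      using \<open>u \<noteq> 0\<close> that by (simp add: sgn_zero_iff)
    then show "\<exists>e. \<forall>t\<in>I. sgn (?d t) = e" by blast
  next
    assume "\<exists>e. \<forall>t\<in>I. sgn (?d t) = e"
    then obtain e where e: "\<And>t. t \<in> I \<Longrightarrow> sgn (?d t) = e" by blast
    have d: "?d t = of_real (norm (?d t)) * e" if "t \<in> I" for t
      using e[OF that] nz[OF that] by (auto simp: sgn_eq)
    have e1: "norm e = 1" using e[OF t0] nz[OF t0] by (auto simp: norm_sgn)
    have ee: "e * cnj e = 1" using e1 by (simp add: complex_norm_square[symmetric])
    have "((\<lambda>t. Im (\<gamma> t * cnj e)) has_derivative (\<lambda>h. 0)) (at t within I)" if t: "t \<in> I" for t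
    proof -
      have "((\<lambda>t. Im (\<gamma> t * cnj e)) has_vector_derivative Im (?d t * cnj e)) (at t within I)"
        using der[OF t]
        by (intro bounded_linear.has_vector_derivative[OF bounded_linear_Im]
            bounded_linear.has_vector_derivative[OF bounded_linear_mult_left])
      moreover have "?d t * cnj e = of_real (norm (?d t))"
        using d[OF t] ee by (metis mult.assoc mult.right_neutral)
      ultimately show ?thesis by (simp add: has_vector_derivative_def)
    qed
    then obtain k where k: "\<And>t. t \<in> I \<Longrightarrow> Im (\<gamma> t * cnj e) = k"
      using has_derivative_zero_constant[of I "\<lambda>t. Im (\<gamma> t * cnj e)"] I(1)
        is_interval_convex by blast
    \<comment> \<open>For a difference \<open>z\<close> of two points, \<open>z * cnj e\<close> is
      real; multiplying by \<open>e\<close> and using \<open>e * cnj e = 1\<close> exhibits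
      \<open>z\<close> as a real multiple of \<open>e\<close>.\<close>
    have "\<gamma> t - \<gamma> t' = Re ((\<gamma> t - \<gamma> t') * cnj e) *\<^sub>R e" if "t \<in> I" "t' \<in> I" for t t'
    proof -
      have "(\<gamma> t - \<gamma> t') * cnj e = of_real (Re ((\<gamma> t - \<gamma> t') * cnj e))"
        using k that by (simp add: complex_eq_iff algebra_simps)
      then have "(\<gamma> t - \<gamma> t') * cnj e * e = of_real (Re ((\<gamma> t - \<gamma> t') * cnj e)) * e"
        by simp
      then show ?thesis using ee by (simp add: mult.assoc mult.commute[of "cnj e"] scaleR_conv_of_real)
    qed
    then show "collinear (\<gamma> ` I)" unfolding collinear_def by blast
  }
qed

section \<open>The differential of the star map\<close>

text \<open>Uniqueness holds at boundary points too, because arbitrarily small steps along each axis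
  remain in the product.\<close>

lemma differential_eqI:
  assumes "is_interval I" "interior I \<noteq> {}" "is_interval J" "interior J \<noteq> {}"
    and "p \<in> I \<times> J" and F: "(F has_derivative D) (at p within I \<times> J)"
  shows "differential (I \<times> J) F p = D"
proof -
  have "D = frechet_derivative F (at p within I \<times> J)"
  proof (rule frechet_derivative_unique_within[OF F])
    show "(F has_derivative frechet_derivative F (at p within I \<times> J)) (at p within I \<times> J)"
      using F frechet_derivative_works differentiableI by blast
    fix i :: "real \<times> real" and e :: real
    assume "i \<in> Basis" "e > 0"
    then show "\<exists>d. 0 < \<bar>d\<bar> \<and> \<bar>d\<bar> < e \<and> p + d *\<^sub>R i \<in> I \<times> J"
      using interval_shift_exists[OF assms(1,2), of "fst p" e]
        interval_shift_exists[OF assms(3,4), of "snd p" e] assms(5)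
      by (cases p) (auto simp: Basis_prod_def)
  qed
  then show ?thesis by (simp add: differential_def)
qed

text \<open>The differential of \<open>\<alpha> \<ast> \<omega>\<close> at \<open>p\<close>. The
  velocities are separate arguments, so that the same algebra serves curves on intervals and
  explicit lines.\<close>

definition star_differential ::
  "(real \<Rightarrow> complex) \<Rightarrow> (real \<Rightarrow> complex) \<Rightarrow> (real \<Rightarrow> complex) \<Rightarrow> (real \<Rightarrow> complex)
    \<Rightarrow> real \<times> real \<Rightarrow> real \<times> real \<Rightarrow> complex \<times> complex" where
  "star_differential \<alpha> \<alpha>' \<omega> \<omega>' p h =
     (of_real (snd h) * (\<omega>' (snd p) * cnj (\<omega> (snd p))) - of_real (fst h) * (\<alpha>' (fst p) * cnj (\<alpha> (fst p))),
      of_real (fst h) * (\<alpha>' (fst p) * \<omega> (snd p)) + of_real (snd h) * (\<alpha> (fst p) * \<omega>' (snd p)))"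

text \<open>The mixed terms of the two components cancel. That the value is real is the Lagrangian
  condition; that it is diagonal gives the induced metric.\<close>

lemma herm_star_differential:
  "herm (star_differential \<alpha> \<alpha>' \<omega> \<omega>' (t, s) (x, y)) (star_differential \<alpha> \<alpha>' \<omega> \<omega>' (t, s) (u, v))
   = of_real (((norm (\<alpha> t))\<^sup>2 + (norm (\<omega> s))\<^sup>2) *
       (x * u * (norm (\<alpha>' t))\<^sup>2 + y * v * (norm (\<omega>' s))\<^sup>2))"
  unfolding herm_def star_differential_def of_real_mult of_real_add complex_norm_square
  by (simp add: algebra_simps)

text \<open>The terms in \<open>x * u\<close> and \<open>y * v\<close> cancel by antisymmetry; the
  remaining products are \<open>\<alpha>' \<omega>'\<close> times the squared moduli of
  \<open>\<alpha>\<close> and of \<open>\<omega>\<close>.\<close>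

lemma dz1_wedge_dz2_star_differential:
  "dz1_wedge_dz2 (star_differential \<alpha> \<alpha>' \<omega> \<omega>' (t, s) (x, y)) (star_differential \<alpha> \<alpha>' \<omega> \<omega>' (t, s) (u, v))
   = - (\<alpha>' t * \<omega>' s) * of_real (((norm (\<alpha> t))\<^sup>2 + (norm (\<omega> s))\<^sup>2) * (x * v - y * u))"
  unfolding dz1_wedge_dz2_def star_differential_def of_real_mult of_real_add of_real_diff complex_norm_square
  by (simp add: algebra_simps)

lemma inner_eq_Re_herm: "z \<bullet> w = Re (herm z w)"
  by (simp add: herm_def inner_prod_def inner_complex_def)

lemma linear_star_differential: "linear (star_differential \<alpha> \<alpha>' \<omega> \<omega>' p)"
  by (rule linearI) (auto simp: star_differential_def algebra_simps scaleR_conv_of_real)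

section \<open>Lagrangian angle of a map with this differential\<close>

text \<open>\<open>F\<close> is any map with the star differential, so translates of
  \<open>curve_star\<close> such as \<open>line_star\<close> are covered. Assumption
  \<open>nz\<close> excludes only common zeros, which admits a line through the origin paired with
  one that avoids it.\<close>

context
  fixes I J :: "real set" and \<alpha> \<alpha>' \<omega> \<omega>' :: "real \<Rightarrow> complex"
    and F :: "real \<times> real \<Rightarrow> complex \<times> complex"
  assumes I: "is_interval I" "interior I \<noteq> {}" and J: "is_interval J" "interior J \<noteq> {}"
    and F: "\<And>p. p \<in> I \<times> J \<Longrightarrow> (F has_derivative star_differential \<alpha> \<alpha>' \<omega> \<omega>' p) (at p within I \<times> J)"
    and cont: "continuous_on I \<alpha>" "continuous_on I \<alpha>'" "continuous_on J \<omega>" "continuous_on J \<omega>'"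
    and nz': "\<And>t. t \<in> I \<Longrightarrow> \<alpha>' t \<noteq> 0" "\<And>s. s \<in> J \<Longrightarrow> \<omega>' s \<noteq> 0"
    and nz: "\<And>t s. t \<in> I \<Longrightarrow> s \<in> J \<Longrightarrow> \<alpha> t \<noteq> 0 \<or> \<omega> s \<noteq> 0"
begin

lemma differential_star:
  "p \<in> I \<times> J \<Longrightarrow> differential (I \<times> J) F p = star_differential \<alpha> \<alpha>' \<omega> \<omega>' p"
  using differential_eqI[OF I J _ F] by blast

lemma star_conformal_factor_pos:
  "t \<in> I \<Longrightarrow> s \<in> J \<Longrightarrow> 0 < (norm (\<alpha> t))\<^sup>2 + (norm (\<omega> s))\<^sup>2"
  using nz[of t s] by (auto simp: add_pos_nonneg add_nonneg_pos)

lemma lagrangian_immersion_star: "lagrangian_immersion_on (I \<times> J) F"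
proof -
  have "F differentiable (at p within I \<times> J)" if "p \<in> I \<times> J" for p
    using F[OF that] by (rule differentiableI)
  moreover have "continuous_on (I \<times> J) (\<lambda>p. differential (I \<times> J) F p v)" for v
  proof (subst continuous_on_cong[OF refl])
    show "differential (I \<times> J) F p v = star_differential \<alpha> \<alpha>' \<omega> \<omega>' p v" if "p \<in> I \<times> J" for p
      using differential_star[OF that] by simp
    show "continuous_on (I \<times> J) (\<lambda>p. star_differential \<alpha> \<alpha>' \<omega> \<omega>' p v)"
      unfolding star_differential_def
      by (intro continuous_intros continuous_on_compose2[OF cont(1)] continuous_on_compose2[OF cont(2)]
          continuous_on_compose2[OF cont(3)] continuous_on_compose2[OF cont(4)]) auto
  qed
  moreover have "inj (differential (I \<times> J) F p)" if "p \<in> I \<times> J" for p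
  proof -
    obtain t s where p: "p = (t, s)" "t \<in> I" "s \<in> J" using \<open>p \<in> I \<times> J\<close> by auto
    \<comment> \<open>A kernel vector has squared length 0, yet this length is a positive factor
      times a positive definite form in \<open>x\<close> and \<open>y\<close>.\<close>
    have "h = 0" if "star_differential \<alpha> \<alpha>' \<omega> \<omega>' p h = 0" for h
    proof -
      obtain x y where h: "h = (x, y)" by (cases h)
      have "herm (star_differential \<alpha> \<alpha>' \<omega> \<omega>' (t, s) (x, y))
              (star_differential \<alpha> \<alpha>' \<omega> \<omega>' (t, s) (x, y)) = 0"
        using that p h by (simp add: herm_def)
      then have "x * x * (norm (\<alpha>' t))\<^sup>2 + y * y * (norm (\<omega>' s))\<^sup>2 = 0"
        unfolding herm_star_differential of_real_eq_0_iff
        using star_conformal_factor_pos[OF p(2,3)] by auto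
      then show "h = 0"
        using nz'(1)[OF p(2)] nz'(2)[OF p(3)] h
        by (simp add: add_nonneg_eq_0_iff zero_prod_def)
    qed
    then show ?thesis
      unfolding differential_star[OF that]
      using linear_injective_0[OF linear_star_differential] by blast
  qed
  moreover have "kaehler (differential (I \<times> J) F p u) (differential (I \<times> J) F p v) = 0"
    if "p \<in> I \<times> J" for p u v
    unfolding differential_star[OF that] kaehler_def
    by (cases p; cases u; cases v) (simp add: herm_star_differential del: of_real_add of_real_mult)
  ultimately show ?thesis
    unfolding lagrangian_immersion_on_def immersion_on_def by blast
qed

lemma area_form_star:
  assumes "t \<in> I" "s \<in> J"
  shows "area_form (I \<times> J) F (t, s) (x, y) (u, v) =
    norm (\<alpha>' t) * norm (\<omega>' s) * ((norm (\<alpha> t))\<^sup>2 + (norm (\<omega> s))\<^sup>2) * (x * v - y * u)"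
proof -
  let ?n = "(norm (\<alpha> t))\<^sup>2 + (norm (\<omega> s))\<^sup>2"
  \<comment> \<open>The metric is diagonal, so its Gram determinant is this product, a perfect
    square.\<close>
  have "?n * (norm (\<alpha>' t))\<^sup>2 * (?n * (norm (\<omega>' s))\<^sup>2) = (norm (\<alpha>' t) * norm (\<omega>' s) * ?n)\<^sup>2"
    by (simp add: power2_eq_square)
  then have "sqrt (?n * (norm (\<alpha>' t))\<^sup>2 * (?n * (norm (\<omega>' s))\<^sup>2)) = norm (\<alpha>' t) * norm (\<omega>' s) * ?n"
    by simp
  then show ?thesis
    using differential_star[of "(t, s)"] assms
    by (simp add: area_form_def induced_metric_def inner_eq_Re_herm herm_star_differential)
qed

text \<open>Both \<open>dz1_wedge_dz2\<close> and the area form are multiples of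
  \<open>dt \<and> ds\<close>; dividing out the moduli of the velocities leaves minus the product of
  the unit tangents as the phase.\<close>

lemma special_lagrangian_star_iff:
  "special_lagrangian_on (I \<times> J) F \<longleftrightarrow>
     (\<exists>\<beta>. \<forall>t\<in>I. \<forall>s\<in>J. - (sgn (\<alpha>' t) * sgn (\<omega>' s)) = cis \<beta>)"
proof -
  have "(\<forall>u v. dz1_wedge_dz2 (differential (I \<times> J) F (t, s) u) (differential (I \<times> J) F (t, s) v)
                   = cis \<beta> * of_real (area_form (I \<times> J) F (t, s) u v)) \<longleftrightarrow>
        - (sgn (\<alpha>' t) * sgn (\<omega>' s)) = cis \<beta>" (is "?L \<longleftrightarrow> ?R")
    if ts: "t \<in> I" "s \<in> J" for t s \<beta>
  proof -
    let ?n = "(norm (\<alpha> t))\<^sup>2 + (norm (\<omega> s))\<^sup>2"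
    have sg: "\<alpha>' t = of_real (norm (\<alpha>' t)) * sgn (\<alpha>' t)" "\<omega>' s = of_real (norm (\<omega>' s)) * sgn (\<omega>' s)"
      using nz'(1)[OF ts(1)] nz'(2)[OF ts(2)] by (auto simp: sgn_eq)
    have "\<alpha>' t * \<omega>' s = of_real (norm (\<alpha>' t) * norm (\<omega>' s)) * (sgn (\<alpha>' t) * sgn (\<omega>' s))"
      by (subst sg(1), subst sg(2)) (simp add: mult_ac)
    then have dz: "dz1_wedge_dz2 (differential (I \<times> J) F (t, s) (x, y)) (differential (I \<times> J) F (t, s) (u, v))
      = - (sgn (\<alpha>' t) * sgn (\<omega>' s)) * of_real (area_form (I \<times> J) F (t, s) (x, y) (u, v))" for x y u v
      using differential_star[of "(t, s)"] ts
      by (simp add: dz1_wedge_dz2_star_differential area_form_star mult_ac)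
    \<comment> \<open>The coordinate frame has nonzero area, so the phase can be recovered from this
      one pair by cancellation.\<close>
    have nz1: "area_form (I \<times> J) F (t, s) (1, 0) (0, 1) \<noteq> 0"
      using area_form_star[OF ts, of 1 0 0 1] nz[OF ts] nz' ts by auto
    show ?thesis
    proof
      assume ?L
      then have "- (sgn (\<alpha>' t) * sgn (\<omega>' s)) * of_real (area_form (I \<times> J) F (t, s) (1, 0) (0, 1))
        = cis \<beta> * of_real (area_form (I \<times> J) F (t, s) (1, 0) (0, 1))"
        using dz by metis
      then show ?R using nz1 by (simp only: mult_cancel_right of_real_eq_0_iff) simp
    next
      assume R: ?R
      show ?L unfolding split_paired_all using dz R by (simp only: split_paired_all) simp
    qed
  qed
  then show ?thesis
    using lagrangian_immersion_star
    by (auto simp: special_lagrangian_on_def lagrangian_angle_def)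
qed

end

section \<open>The star of two regular curves\<close>

text \<open>Each integral depends on one parameter only and is differentiated by the fundamental
  theorem; the second component follows from the product rule.\<close>

lemma curve_star_has_derivative:
  assumes "is_interval I\<^sub>1" "is_interval I\<^sub>2" "t\<^sub>0 \<in> I\<^sub>1" "s\<^sub>0 \<in> I\<^sub>2"
    and "regular_curve I\<^sub>1 \<alpha>" "regular_curve I\<^sub>2 \<omega>" "p \<in> I\<^sub>1 \<times> I\<^sub>2"
  shows "(curve_star I\<^sub>1 I\<^sub>2 t\<^sub>0 s\<^sub>0 \<alpha> \<omega> has_derivative
     star_differential \<alpha> (\<lambda>t. vector_derivative \<alpha> (at t within I\<^sub>1))
       \<omega> (\<lambda>s. vector_derivative \<omega> (at s within I\<^sub>2)) p) (at p within I\<^sub>1 \<times> I\<^sub>2)"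
proof -
  obtain t s where p: "p = (t, s)" "t \<in> I\<^sub>1" "s \<in> I\<^sub>2" using assms(7) by auto
  have ftc: "((\<lambda>u. LBINT y=c..u. vector_derivative \<gamma> (at y within I) * cnj (\<gamma> y))
      has_vector_derivative vector_derivative \<gamma> (at x within I) * cnj (\<gamma> x)) (at x within I)"
    if "is_interval I" "c \<in> I" "x \<in> I" "regular_curve I \<gamma>" for I c x \<gamma>
    using that differentiable_imp_continuous_on[of \<gamma> I]
    by (intro interval_integral_has_vector_derivative continuous_intros)
      (auto simp: regular_curve_def differentiable_on_def)
  have der: "(\<gamma> has_vector_derivative vector_derivative \<gamma> (at x within I)) (at x within I)"
    if "regular_curve I \<gamma>" "x \<in> I" for I \<gamma> x
    using that by (auto simp: regular_curve_def vector_derivative_works)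
  have "((\<lambda>p. ((LBINT y=s\<^sub>0..snd p. vector_derivative \<omega> (at y within I\<^sub>2) * cnj (\<omega> y))
        - (LBINT x=t\<^sub>0..fst p. vector_derivative \<alpha> (at x within I\<^sub>1) * cnj (\<alpha> x)),
      \<alpha> (fst p) * \<omega> (snd p))) has_derivative
     star_differential \<alpha> (\<lambda>t. vector_derivative \<alpha> (at t within I\<^sub>1))
       \<omega> (\<lambda>s. vector_derivative \<omega> (at s within I\<^sub>2)) (t, s)) (at (t, s) within I\<^sub>1 \<times> I\<^sub>2)"
    using has_derivative_Pair[OF
        has_derivative_diff[OF
          has_derivative_snd_compose[OF ftc[OF assms(2,4) p(3) assms(6)], of t I\<^sub>1]
          has_derivative_fst_compose[OF ftc[OF assms(1,3) p(2) assms(5)], of s I\<^sub>2]]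
        has_derivative_mult[OF
          has_derivative_fst_compose[OF der[OF assms(5) p(2)], of s I\<^sub>2]
          has_derivative_snd_compose[OF der[OF assms(6) p(3)], of t I\<^sub>1]]]
    by (rule has_derivative_eq_rhs)
      (auto simp: star_differential_def scaleR_conv_of_real fun_eq_iff algebra_simps)
  then show ?thesis by (simp add: curve_star_def case_prod_beta' p(1))
qed

text \<open>A product of a function of \<open>t\<close> and a function of \<open>s\<close>, both of
  modulus one, is constant exactly when each factor is; constant unit tangents then mean straight
  curves.\<close>

lemma special_lagrangian_curve_star_iff:
  assumes I: "is_interval I\<^sub>1" "interior I\<^sub>1 \<noteq> {}" "is_interval I\<^sub>2" "interior I\<^sub>2 \<noteq> {}"
    and base: "t\<^sub>0 \<in> I\<^sub>1" "s\<^sub>0 \<in> I\<^sub>2"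
    and reg: "regular_curve I\<^sub>1 \<alpha>" "regular_curve I\<^sub>2 \<omega>"
    and nz: "\<And>t s. t \<in> I\<^sub>1 \<Longrightarrow> s \<in> I\<^sub>2 \<Longrightarrow> \<alpha> t \<noteq> 0 \<or> \<omega> s \<noteq> 0"
  shows "special_lagrangian_on (I\<^sub>1 \<times> I\<^sub>2) (curve_star I\<^sub>1 I\<^sub>2 t\<^sub>0 s\<^sub>0 \<alpha> \<omega>)
    \<longleftrightarrow> collinear (\<alpha> ` I\<^sub>1) \<and> collinear (\<omega> ` I\<^sub>2)"
proof -
  let ?a = "\<lambda>t. sgn (vector_derivative \<alpha> (at t within I\<^sub>1))"
  let ?w = "\<lambda>s. sgn (vector_derivative \<omega> (at s within I\<^sub>2))"
  have c: "continuous_on I\<^sub>1 \<alpha>" "continuous_on I\<^sub>2 \<omega>"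
    using reg by (auto simp: regular_curve_def differentiable_on_def
        intro: differentiable_imp_continuous_on)
  have n: "norm (?a t) = 1" "norm (?w s) = 1" if "t \<in> I\<^sub>1" "s \<in> I\<^sub>2" for t s
    using reg that by (auto simp: regular_curve_def norm_sgn)
  have "special_lagrangian_on (I\<^sub>1 \<times> I\<^sub>2) (curve_star I\<^sub>1 I\<^sub>2 t\<^sub>0 s\<^sub>0 \<alpha> \<omega>) \<longleftrightarrow>
      (\<exists>\<beta>. \<forall>t\<in>I\<^sub>1. \<forall>s\<in>I\<^sub>2. - (?a t * ?w s) = cis \<beta>)"
    by (rule special_lagrangian_star_iff[OF I curve_star_has_derivative[OF I(1,3) base reg] c(1) _ c(2)])
      (use reg nz in \<open>auto simp: regular_curve_def\<close>)
  also have "\<dots> \<longleftrightarrow> (\<exists>e. \<forall>t\<in>I\<^sub>1. ?a t = e) \<and> (\<exists>e. \<forall>s\<in>I\<^sub>2. ?w s = e)" (is "?L \<longleftrightarrow> ?R")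
  proof
    assume ?L
    then obtain \<beta> where b: "\<And>t s. t \<in> I\<^sub>1 \<Longrightarrow> s \<in> I\<^sub>2 \<Longrightarrow> - (?a t * ?w s) = cis \<beta>" by blast
    have "?a t = ?a t\<^sub>0" if "t \<in> I\<^sub>1" for t
    proof -
      \<comment> \<open>With the other parameter frozen at its base point, the unit tangent there
        cancels.\<close>
      have "?a t * ?w s\<^sub>0 = ?a t\<^sub>0 * ?w s\<^sub>0" using b[OF that base(2)] b[OF base] by (metis minus_equation_iff)
      then show ?thesis using n[OF base] by auto
    qed
    moreover have "?w s = ?w s\<^sub>0" if "s \<in> I\<^sub>2" for s
    proof -
      have "?a t\<^sub>0 * ?w s = ?a t\<^sub>0 * ?w s\<^sub>0" using b[OF base(1) that] b[OF base] by (metis minus_equation_iff)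
      then show ?thesis using n[OF base] by auto
    qed
    ultimately show ?R by blast
  next
    assume ?R
    then have e: "- (?a t * ?w s) = - (?a t\<^sub>0 * ?w s\<^sub>0)" if "t \<in> I\<^sub>1" "s \<in> I\<^sub>2" for t s
      using that base by metis
    \<comment> \<open>A number of modulus one is \<open>cis\<close> of its argument, which supplies
      the constant angle.\<close>
    have "norm (- (?a t\<^sub>0 * ?w s\<^sub>0)) = 1" using n[OF base] by (simp add: norm_mult)
    then have "- (?a t\<^sub>0 * ?w s\<^sub>0) = cis (Arg (- (?a t\<^sub>0 * ?w s\<^sub>0)))"
      by (metis cis_Arg norm_zero sgn_eq div_by_1 of_real_1 zero_neq_one)
    with e show ?L by metis
  qed
  also have "\<dots> \<longleftrightarrow> collinear (\<alpha> ` I\<^sub>1) \<and> collinear (\<omega> ` I\<^sub>2)"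
    using regular_curve_collinear_iff[OF I(1,2) reg(1)] regular_curve_collinear_iff[OF I(3,4) reg(2)]
    by simp
  finally show ?thesis .
qed

section \<open>Pairs of horizontal lines\<close>

lemma vector_derivative_horizontal_line:
  "vector_derivative (\<lambda>t. of_real t + \<i> * of_real a :: complex) (at x) = 1"
  by (rule vector_derivative_at) (auto intro!: derivative_eq_intros has_vector_derivative_real_field)

lemma integral_horizontal_line:
  "(LBINT y=c..x. vector_derivative (\<lambda>t. of_real t + \<i> * of_real a) (at y)
       * cnj (of_real y + \<i> * of_real a))
   = of_real (x\<^sup>2 / 2) - \<i> * of_real (a * x) - (of_real (c\<^sup>2 / 2) - \<i> * of_real (a * c))"
  for c x a :: real
proof -
  \<comment> \<open>The velocity is 1, so the integrand is \<open>x - \<i> * a\<close>; its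
    primitive is checked on real and imaginary parts separately.\<close>
  have "((\<lambda>x. of_real (x\<^sup>2 / 2) - \<i> * of_real (a * x)) has_vector_derivative
      cnj (of_real x + \<i> * of_real a)) (at x within S)" for x S
    unfolding has_vector_derivative_complex_iff
    by (auto intro!: derivative_eq_intros)
  then show ?thesis
    unfolding vector_derivative_horizontal_line mult_1
    by (intro interval_integral_FTC_finite continuous_intros)
qed

lemma curve_star_horizontal_lines:
  "\<exists>T. \<forall>p. curve_star UNIV UNIV t\<^sub>0 s\<^sub>0
     (\<lambda>t. of_real t + \<i> * of_real a) (\<lambda>s. of_real s + \<i> * of_real b) p = line_star a b p + T"
proof (intro exI allI)
  fix p :: "real \<times> real"
  \<comment> \<open>The translation collects the values of the primitives at the base points and, in
    the second component, the product \<open>(\<i> * a) * (\<i> * b) = - a * b\<close>.\<close>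
  show "curve_star UNIV UNIV t\<^sub>0 s\<^sub>0
     (\<lambda>t. of_real t + \<i> * of_real a) (\<lambda>s. of_real s + \<i> * of_real b) p = line_star a b p +
    (of_real (t\<^sub>0\<^sup>2 / 2) - \<i> * of_real (a * t\<^sub>0) - (of_real (s\<^sub>0\<^sup>2 / 2) - \<i> * of_real (b * s\<^sub>0)),
      - of_real (a * b))"
    unfolding curve_star_def line_star_def case_prod_beta' integral_horizontal_line
    by (simp add: complex_eq_iff algebra_simps diff_divide_distrib)
qed

text \<open>A translation leaves the differential unchanged, so the angle criterion applies with
  both velocities equal to 1. The two lines have a common zero only when
  \<open>a = b = 0\<close>.\<close>

lemma special_lagrangian_line_star:
  assumes "(a, b) \<noteq> (0, 0)"
  shows "special_lagrangian_on UNIV (line_star a b)"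
proof -
  let ?\<alpha> = "\<lambda>t. of_real t + \<i> * of_real a :: complex"
  let ?\<omega> = "\<lambda>s. of_real s + \<i> * of_real b :: complex"
  obtain T where "\<And>p. curve_star UNIV UNIV 0 0 ?\<alpha> ?\<omega> p = line_star a b p + T"
    using curve_star_horizontal_lines by blast
  then have eq: "line_star a b = (\<lambda>p. curve_star UNIV UNIV 0 0 ?\<alpha> ?\<omega> p - T)"
    by (simp add: fun_eq_iff)
  have d: "(\<lambda>t. of_real t + \<i> * of_real c :: complex) differentiable (at x)" for c x :: real
    by (auto intro!: derivative_intros)
  have reg: "regular_curve UNIV (\<lambda>t. of_real t + \<i> * of_real c)" for c :: real
    using d by (simp add: regular_curve_def vector_derivative_horizontal_line)
  have der: "(line_star a b has_derivative star_differential ?\<alpha> (\<lambda>_. 1) ?\<omega> (\<lambda>_. 1) p) (at p within UNIV \<times> UNIV)" for p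
    unfolding eq
    using has_derivative_diff[OF curve_star_has_derivative[OF _ _ _ _ reg reg, where p = p] has_derivative_const]
    by (simp add: vector_derivative_horizontal_line)
  have "special_lagrangian_on (UNIV \<times> UNIV) (line_star a b) \<longleftrightarrow>
      (\<exists>\<beta>. \<forall>t\<in>(UNIV :: real set). \<forall>s\<in>(UNIV :: real set). - (sgn 1 * sgn 1) = cis \<beta>)"
    by (rule special_lagrangian_star_iff[OF _ _ _ _ der])
      (use assms in \<open>auto intro!: continuous_intros simp: complex_eq_iff\<close>)
  \<comment> \<open>Both unit tangents are 1, so the constant phase is
    \<open>- 1 = cis pi\<close>.\<close>
  then show ?thesis using exI[of "\<lambda>\<beta>. - 1 = cis \<beta>" pi] by simp
qed

text \<open>
  With \<open>z = t + i s\<close>, the components of \<^term>\<open>line_star a b\<close> regroup as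
  \<open>Im z\<^sub>1 + i Im z\<^sub>2 = (a + i b) z\<close> and \<open>Re z\<^sub>1 - i Re z\<^sub>2 = - z\<^sup>2 / 2\<close>.
\<close>

lemma line_star_isometric_graph:
  assumes "(a, b) \<noteq> (0, 0)"
    and c: "c = - ((of_real a - \<i> * of_real b)\<^sup>2 / of_real (2 * (a\<^sup>2 + b\<^sup>2)\<^sup>2))"
  shows "\<exists>f. orthogonal_transformation f \<and>
    f ` range (line_star a b) = {(z, c * z\<^sup>2) | z. z \<in> (UNIV :: complex set)}"
proof (intro exI conjI)
  \<comment> \<open>Permutes the four real coordinates and reverses one of them: a real linear
    isometry that is not complex linear.\<close>
  define f :: "complex \<times> complex \<Rightarrow> complex \<times> complex"
    where "f = (\<lambda>(z, w). (Complex (Im z) (Im w), Complex (Re z) (- Re w)))"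
  show "orthogonal_transformation f"
    unfolding orthogonal_transformation_def
    by (auto simp: f_def inner_prod_def inner_complex_def complex_eq_iff intro!: linearI)
  let ?k = "Complex a b"
  have k: "?k \<noteq> 0" using assms(1) by (auto simp: complex_eq_iff)
  have "of_real (a\<^sup>2 + b\<^sup>2) = ?k * cnj ?k" "of_real a - \<i> * of_real b = cnj ?k"
    by (auto simp: complex_eq_iff power2_eq_square)
  \<comment> \<open>With \<open>?k\<close> for \<open>a + \<i> * b\<close>, the conjugates cancel
    and \<open>c = - 1 / (2 * ?k^2)\<close>; this is what turns \<open>c * (?k * z)^2\<close> into
    \<open>- z^2 / 2\<close>.\<close>
  then have "c = - ((cnj ?k)\<^sup>2 / (2 * (?k * cnj ?k)\<^sup>2))"
    unfolding c of_real_mult of_real_power by simp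
  also have "\<dots> = - 1 / (2 * ?k\<^sup>2)" using k by (simp add: field_simps power2_eq_square)
  finally have ck0: "c * (2 * ?k\<^sup>2) = - 1" using k by simp
  have "c * (?k * z)\<^sup>2 = c * (2 * ?k\<^sup>2) * z\<^sup>2 / 2" for z
    by (simp add: power_mult_distrib)
  then have ck: "c * (?k * z)\<^sup>2 = - z\<^sup>2 / 2" for z unfolding ck0 by simp
  have fl: "f (line_star a b (t, s)) = (?k * Complex t s, c * (?k * Complex t s)\<^sup>2)" for t s
    unfolding ck by (simp add: f_def line_star_def complex_eq_iff power2_eq_square field_simps)
  show "f ` range (line_star a b) = {(z, c * z\<^sup>2) | z. z \<in> UNIV}"
  proof (intro equalityI subsetI)
    fix q assume "q \<in> {(z, c * z\<^sup>2) | z. z \<in> UNIV}"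
    then obtain z where z: "q = (z, c * z\<^sup>2)" by blast
    \<comment> \<open>Since \<open>?k\<close> is invertible, the parameter \<open>z / ?k\<close>
      reaches the point of the graph over \<open>z\<close>.\<close>
    have "q = f (line_star a b (Re (z / ?k), Im (z / ?k)))"
      unfolding fl z complex.collapse using k by simp
    then show "q \<in> f ` range (line_star a b)" by blast
  qed (use fl in force)
qed

section \<open>The totally geodesic plane\<close>

text \<open>Every complex number is a square, so the map covers the whole plane. Its differential
  vanishes at the origin, hence the geometric properties are proved for the parametrization
  \<open>real_plane\<close> of the same image.\<close>

lemma range_line_star_0: "range (line_star 0 0) = range real_plane"
proof (intro equalityI subsetI)
  fix q assume "q \<in> range real_plane"
  then obtain x y where q: "q = (of_real x, of_real y)" by (auto simp: real_plane_def)
  \<comment> \<open>For \<open>z = t + \<i> * s\<close> the two components are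
    \<open>- Re (z^2) / 2\<close> and \<open>Im (z^2) / 2\<close>, so
    \<open>z^2 = - 2 * x + 2 * \<i> * y\<close> has to be solved.\<close>
  define z where "z = csqrt (2 * Complex (- x) y)"
  have "z\<^sup>2 = 2 * Complex (- x) y" by (simp add: z_def)
  then have "(Re z)\<^sup>2 - (Im z)\<^sup>2 = - 2 * x" "Re z * Im z = y"
    by (auto simp: complex_eq_iff power2_eq_square)
  then have "q = line_star 0 0 (Re z, Im z)"
    unfolding q by (simp add: line_star_def complex_eq_iff)
  then show "q \<in> range (line_star 0 0)" by blast
next
  fix q assume "q \<in> range (line_star 0 0)"
  then obtain t s where "q = line_star 0 0 (t, s)" by auto
  then have "q = real_plane ((s\<^sup>2 - t\<^sup>2) / 2, t * s)"
    by (simp add: line_star_def real_plane_def)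
  then show "q \<in> range real_plane" by blast
qed

lemma bounded_linear_real_plane: "bounded_linear real_plane"
  by (intro linear_conv_bounded_linear[THEN iffD1] linearI)
    (auto simp: real_plane_def scaleR_conv_of_real)

lemma differential_real_plane: "differential UNIV real_plane p = real_plane"
  unfolding differential_def
  by (metis bounded_linear_real_plane bounded_linear_imp_has_derivative frechet_derivative_at)

lemma immersion_real_plane: "immersion_on UNIV real_plane"
proof -
  have "real_plane differentiable at p" for p
    using bounded_linear_real_plane bounded_linear_imp_differentiable by blast
  moreover have "inj real_plane" by (auto simp: real_plane_def inj_on_def)
  ultimately show ?thesis by (simp add: immersion_on_def differential_real_plane)
qed

lemma lagrangian_immersion_real_plane: "lagrangian_immersion_on UNIV real_plane"
  unfolding lagrangian_immersion_on_def differential_real_plane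
  using immersion_real_plane by (simp add: kaehler_def herm_def real_plane_def case_prod_beta')

lemma totally_geodesic_real_plane: "totally_geodesic_on UNIV real_plane"
proof -
  \<comment> \<open>The differential does not depend on the point, so the second derivative is 0,
    and 0 is tangential.\<close>
  have "real_plane (0, 0) = 0" by (simp add: real_plane_def zero_prod_def)
  then have "0 \<in> range real_plane" by (metis rangeI)
  then show ?thesis
    using immersion_real_plane
    by (simp add: totally_geodesic_on_def differential_real_plane)
qed

section \<open>Assembly of the four claims\<close>

theorem corollary3p1:
  shows
   "(\<forall>(I\<^sub>1 :: real set) (I\<^sub>2 :: real set) (\<alpha> :: real \<Rightarrow> complex) (\<omega> :: real \<Rightarrow> complex) t\<^sub>0 s\<^sub>0.
       is_interval I\<^sub>1 \<and> interior I\<^sub>1 \<noteq> {} \<and> is_interval I\<^sub>2 \<and> interior I\<^sub>2 \<noteq> {} \<and>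
       t\<^sub>0 \<in> I\<^sub>1 \<and> s\<^sub>0 \<in> I\<^sub>2 \<and>
       regular_curve I\<^sub>1 \<alpha> \<and> regular_curve I\<^sub>2 \<omega> \<and>
       (\<forall>t\<in>I\<^sub>1. \<alpha> t \<noteq> 0) \<and> (\<forall>s\<in>I\<^sub>2. \<omega> s \<noteq> 0) \<longrightarrow>
       (special_lagrangian_on (I\<^sub>1 \<times> I\<^sub>2) (curve_star I\<^sub>1 I\<^sub>2 t\<^sub>0 s\<^sub>0 \<alpha> \<omega>)
          \<longleftrightarrow> collinear (\<alpha> ` I\<^sub>1) \<and> collinear (\<omega> ` I\<^sub>2)))
    \<and>
    (\<forall>(a :: real) (b :: real) t\<^sub>0 s\<^sub>0. \<exists>T :: complex \<times> complex. \<forall>p.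
       curve_star UNIV UNIV t\<^sub>0 s\<^sub>0
         (\<lambda>t. of_real t + \<i> * of_real a) (\<lambda>s. of_real s + \<i> * of_real b) p
       = line_star a b p + T)
    \<and>
    ((\<forall>t s. line_star 0 0 (t, s) = (of_real ((s\<^sup>2 - t\<^sup>2) / 2), of_real (t * s))) \<and>
     range (line_star 0 0) = range real_plane \<and>
     lagrangian_immersion_on UNIV real_plane \<and> totally_geodesic_on UNIV real_plane)
    \<and>
    (\<forall>(a :: real) (b :: real). (a, b) \<noteq> (0, 0) \<longrightarrow>
       special_lagrangian_on UNIV (line_star a b) \<and>
       (\<exists>c :: complex.
          c = - ((of_real a - \<i> * of_real b)\<^sup>2 / of_real (2 * (a\<^sup>2 + b\<^sup>2)\<^sup>2)) \<and> c \<noteq> 0 \<and>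
          (\<exists>f :: complex \<times> complex \<Rightarrow> complex \<times> complex.
             orthogonal_transformation f \<and>
             f ` range (line_star a b) = {(z, c * z\<^sup>2) | z. z \<in> (UNIV :: complex set)})))"
proof (intro conjI allI impI)
  fix I\<^sub>1 I\<^sub>2 :: "real set" and \<alpha> \<omega> :: "real \<Rightarrow> complex" and t\<^sub>0 s\<^sub>0
  assume "is_interval I\<^sub>1 \<and> interior I\<^sub>1 \<noteq> {} \<and> is_interval I\<^sub>2 \<and> interior I\<^sub>2 \<noteq> {} \<and>
       t\<^sub>0 \<in> I\<^sub>1 \<and> s\<^sub>0 \<in> I\<^sub>2 \<and>
       regular_curve I\<^sub>1 \<alpha> \<and> regular_curve I\<^sub>2 \<omega> \<and>
       (\<forall>t\<in>I\<^sub>1. \<alpha> t \<noteq> 0) \<and> (\<forall>s\<in>I\<^sub>2. \<omega> s \<noteq> 0)"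
  then show "special_lagrangian_on (I\<^sub>1 \<times> I\<^sub>2) (curve_star I\<^sub>1 I\<^sub>2 t\<^sub>0 s\<^sub>0 \<alpha> \<omega>)
          \<longleftrightarrow> collinear (\<alpha> ` I\<^sub>1) \<and> collinear (\<omega> ` I\<^sub>2)"
    by (intro special_lagrangian_curve_star_iff) auto
next
  fix a b :: real
  assume ab: "(a, b) \<noteq> (0, 0)"
  show "special_lagrangian_on UNIV (line_star a b)"
    using special_lagrangian_line_star[OF ab] .
  let ?c = "- ((of_real a - \<i> * of_real b)\<^sup>2 / of_real (2 * (a\<^sup>2 + b\<^sup>2)\<^sup>2)) :: complex"
  have "of_real a - \<i> * of_real b \<noteq> (0 :: complex)" "2 * (a\<^sup>2 + b\<^sup>2)\<^sup>2 \<noteq> 0"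
    using ab by (auto simp: complex_eq_iff sum_power2_eq_zero_iff)
  then have "?c \<noteq> 0"
    by (simp only: neg_equal_0_iff_equal divide_eq_0_iff power_eq_0_iff of_real_eq_0_iff) simp
  with line_star_isometric_graph[OF ab refl]
  show "\<exists>c. c = ?c \<and> c \<noteq> 0 \<and> (\<exists>f. orthogonal_transformation f \<and>
     f ` range (line_star a b) = {(z, c * z\<^sup>2) | z. z \<in> UNIV})"
    by blast
qed (use curve_star_horizontal_lines range_line_star_0 lagrangian_immersion_real_plane
    totally_geodesic_real_plane in \<open>auto simp: line_star_def\<close>)

end
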